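(* For any integer $N\geq 3$, the $0$-th rhythm polynomial modulo $N$, written in the variables $y_j$ ($j\in\mathbf{Z}_{N,\pm}$), satisfies $$Bav_N^0=\sum_{(a,b)\in Par_N\setminus\{(0,0)\}}f_{[a,b]}+f_{[0,0]}^N .$$
   Context: Let $N\ge 3$ and $\mathbf{Z}_N=\{0,1,\dots,N-1\}$. For an integer $m$, $\langle m\rangle_N\in\mathbf{Z}_N$ is its least nonnegative remainder modulo $N$; $a+_Nb=\langle a+b\rangle_N$, $a-_Nb=\langle a-b\rangle_N$. For $a,b\in\mathbf{Z}_N$ put $av_{\mathbf{Z}_N}(a,b)=a+_N\left\lfloor\frac{b-_Na}{2}\right\rfloor$. Boolean average. For $\mathbf{v}=(v_0,\dots,v_{N-1})\in\mathbf{F}_2^N$ let $a_0<a_1<\dots<a_{n-1}$ be the elements of $\{i\in\mathbf{Z}_N: v_i=1\}$ in increasing order. $Bav(\mathbf{v})\in\mathbf{F}_2^N$ is the vector whose $i$-th coordinate is $1$ exactly when $i=av_{\mathbf{Z}_N}(a_k,a_{k+1})$ for some $0\le k\le n-1$, where $a_n:=a_0$ (so $Bav(\mathbf 0)=\mathbf 0$, and $Bav(\mathbf v)=\mathbf v$ if $n=1$). $Bav_N^0(\mathbf{v})\in\mathbf{F}_2$ denotes the $0$-th coordinate of $Bav(\mathbf{v})$; it is called the $0$-th rhythm polynomial modulo $N$. Index set. $\mathbf{Z}_{N,\pm}=\{-\lfloor\frac{N-1}{2}\rfloor,\dots,\lfloor\frac N2\rfloor\}$, and $\varphi_N:\mathbf{Z}_N\to\mathbf{Z}_{N,\pm}$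 is the bijection with $\varphi_N(k)=k$ if $0\le k\le\lfloor\frac N2\rfloor$ and $\varphi_N(k)=k-N$ if $\lfloor\frac N2\rfloor<k\le N-1$. Variables. The variables $y_j$, $j\in\mathbf{Z}_{N,\pm}$, are the negated coordinates: $y_{\varphi_N(i)}=v_i+1$ for $i\in\mathbf{Z}_N$. Boolean polynomials are elements of $\mathbf{F}_2[y_j : j\in\mathbf{Z}_{N,\pm}]/(y_j^2-y_j)$, i.e. are identified with $\mathbf{F}_2$-valued functions. Parental pairs. $Par_N=\{(a,b)\in\mathbf{Z}_{N,\pm}\times\mathbf{Z}_{N,\pm}: av_{\mathbf{Z}_N}(\varphi_N^{-1}(a),\varphi_N^{-1}(b))=0\}$. (Every $(a,b)\in Par_N\setminus\{(0,0)\}$ satisfies $a<b$.) Polynomials. For $(a,b)\in Par_N\setminus\{(0,0)\}$, $f_{[a,b]}=(y_a+1)\left(\prod_{k=a+1}^{b-1}y_k\right)(y_b+1)$; and $f_{[0,0]}^N=(y_0+1)\prod_{k\in\mathbf{Z}_{N,\pm}\setminus\{0\}}y_k$. *)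

theory Defs
  imports Complex_Main "HOL-Library.Z2" "HOL-Library.FuncSet"
begin

text \<open>
  The field $\mathbf{F}_2$ is the type \<^typ>\<open>bit\<close>. A vector over $\mathbf{F}_2$ indexed by a finite set
  \<open>I\<close> of integers is an extensional function on \<open>I\<close>. A Boolean polynomial in the
  variables $y_j$ is identified with the $\mathbf{F}_2$-valued function it induces, so its value
  is written as a function of the assignment \<open>y\<close>, and equality of Boolean polynomials is
  equality at every point.
\<close>

definition Zmod :: "int \<Rightarrow> int set" where
  "Zmod N = {0..<N}"

definition F2_vectors :: "int set \<Rightarrow> (int \<Rightarrow> bit) set" where
  "F2_vectors I = I \<rightarrow>\<^sub>E (UNIV :: bit set)"

definition add_mod :: "int \<Rightarrow> int \<Rightarrow> int \<Rightarrow> int" where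
  "add_mod N a b = (a + b) mod N"

definition sub_mod :: "int \<Rightarrow> int \<Rightarrow> int \<Rightarrow> int" where
  "sub_mod N a b = (a - b) mod N"

definition av :: "int \<Rightarrow> int \<Rightarrow> int \<Rightarrow> int" where
  "av N a b = add_mod N a (sub_mod N b a div 2)"

definition onsets :: "int \<Rightarrow> (int \<Rightarrow> bit) \<Rightarrow> int list" where
  "onsets N v = sorted_list_of_set {i \<in> Zmod N. v i = 1}"

text \<open>The index \<open>(k + 1) mod n\<close> implements the convention $a_n := a_0$.\<close>

definition Bav :: "int \<Rightarrow> (int \<Rightarrow> bit) \<Rightarrow> int \<Rightarrow> bit" where
  "Bav N v = (let a = onsets N v; n = length a in
     (\<lambda>i\<in>Zmod N. of_bool (\<exists>k<n. i = av N (a ! k) (a ! ((k + 1) mod n)))))"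

definition Bav0 :: "int \<Rightarrow> (int \<Rightarrow> bit) \<Rightarrow> bit" where
  "Bav0 N v = Bav N v 0"

definition Zpm :: "int \<Rightarrow> int set" where
  "Zpm N = {- ((N - 1) div 2) .. N div 2}"

definition phi :: "int \<Rightarrow> int \<Rightarrow> int" where
  "phi N k = (if k \<le> N div 2 then k else k - N)"

definition phi_inv :: "int \<Rightarrow> int \<Rightarrow> int" where
  "phi_inv N = inv_into (Zmod N) (phi N)"

lemma bij_betw_phi: "bij_betw (phi N) (Zmod N) (Zpm N)"
proof (rule bij_betw_imageI)
  show "inj_on (phi N) (Zmod N)"
    by (auto simp: inj_on_def phi_def Zmod_def split: if_splits)
  show "phi N ` Zmod N = Zpm N"
  proof
    show "phi N ` Zmod N \<subseteq> Zpm N"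
      by (auto simp: phi_def Zmod_def Zpm_def)
    show "Zpm N \<subseteq> phi N ` Zmod N"
    proof
      fix j assume j: "j \<in> Zpm N"
      show "j \<in> phi N ` Zmod N"
      proof (cases "j \<ge> 0")
        case True
        with j have "j \<in> Zmod N" "phi N j = j"
          by (auto simp: phi_def Zmod_def Zpm_def)
        then show ?thesis by force
      next
        case False
        with j have "j + N \<in> Zmod N" "phi N (j + N) = j"
          by (auto simp: phi_def Zmod_def Zpm_def)
        then show ?thesis by force
      qed
    qed
  qed
qed

text \<open>The values of the variables $y_j$ at the point \<open>v\<close>, that is, $y_{\varphi_N(i)} = v_i + 1$.\<close>

definition negated_coords :: "int \<Rightarrow> (int \<Rightarrow> bit) \<Rightarrow> int \<Rightarrow> bit" where
  "negated_coords N v = (\<lambda>j\<in>Zpm N. v (phi_inv N j) + 1)"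

lemma negated_coords_phi:
  assumes "i \<in> Zmod N"
  shows "negated_coords N v (phi N i) = v i + 1"
  using assms bij_betw_phi[of N]
  by (simp add: negated_coords_def phi_inv_def bij_betw_def)
     (metis imageI)

definition Par :: "int \<Rightarrow> (int \<times> int) set" where
  "Par N = {(a, b). a \<in> Zpm N \<and> b \<in> Zpm N \<and> av N (phi_inv N a) (phi_inv N b) = 0}"

definition f_pair :: "int \<Rightarrow> int \<Rightarrow> (int \<Rightarrow> bit) \<Rightarrow> bit" where
  "f_pair a b y = (y a + 1) * (\<Prod>k\<in>{a + 1..b - 1}. y k) * (y b + 1)"

definition f_zero :: "int \<Rightarrow> (int \<Rightarrow> bit) \<Rightarrow> bit" where
  "f_zero N y = (y 0 + 1) * (\<Prod>k\<in>Zpm N - {0}. y k)"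

end

theory Submission
  imports Defs
begin

text \<open>
  Two elements \<open>p\<close>, \<open>q\<close> of a subset of $\mathbf{Z}_N$ are cyclically consecutive exactly when no
  element of the subset lies strictly inside the arc from \<open>p\<close> to \<open>q\<close>. The pairs averaging to \<open>0\<close>
  are parametrised by the arc length \<open>d = (b - a) mod N\<close>: they are
  $(-\lfloor d/2\rfloor, \lceil d/2\rceil)$ for $0 \le d < N$. So the $0$-th coordinate is \<open>1\<close> iff
  some \<open>d\<close> gives a consecutive pair of onsets. For \<open>0 < d < e\<close> an endpoint of the interval of \<open>d\<close>
  lies strictly inside that of \<open>e\<close>, and for \<open>d = 0\<close> the arc is the full circle; hence at most
  one \<open>d\<close> gives a consecutive pair, and the sum over \<^typ>\<open>bit\<close> is a disjunction.
\<close>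

section \<open>Indicator values under finite products and sums\<close>

lemma prod_of_bool:
  assumes "finite A"
  shows "(\<Prod>x\<in>A. of_bool (P x)) = (of_bool (\<forall>x\<in>A. P x) :: 'a :: comm_semiring_1)"
  using assms by induction auto

text \<open>At most one term is nonzero, so the characteristic does not matter: this is how addition
  over \<open>bit\<close> comes to express a disjunction.\<close>

lemma sum_of_bool_at_most_one:
  assumes "finite A" and "\<And>x y. x \<in> A \<Longrightarrow> y \<in> A \<Longrightarrow> P x \<Longrightarrow> P y \<Longrightarrow> x = y"
  shows "(\<Sum>x\<in>A. of_bool (P x)) = (of_bool (\<exists>x\<in>A. P x) :: 'a :: semiring_1)"
proof (cases "\<exists>x\<in>A. P x")
  case True
  then obtain a where a: "a \<in> A" "P a" by blast
  have "(\<Sum>x\<in>A. of_bool (P x)) = (\<Sum>x\<in>{a}. of_bool (P x) :: 'a)"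
    by (rule sum.mono_neutral_right) (use assms a in auto)
  with a show ?thesis by auto
qed (auto intro: sum.neutral)

section \<open>Cyclically consecutive elements versus successors in the sorted list\<close>

text \<open>
  The number of interior points of the arc from \<open>p\<close> to \<open>q\<close> is \<open>(q - p - 1) mod N\<close>; for \<open>p = q\<close>
  this is \<open>N - 1\<close>, i.e. the arc is the full circle, matching $a_n = a_0$ for \<open>n = 1\<close>.
\<close>

definition cyclic_consecutive :: "int \<Rightarrow> int set \<Rightarrow> int \<Rightarrow> int \<Rightarrow> bool" where
  "cyclic_consecutive N S p q \<longleftrightarrow>
     p \<in> S \<and> q \<in> S \<and> (\<forall>j\<in>{1..(q - p - 1) mod N}. (p + j) mod N \<notin> S)"

text \<open>From \<open>p\<close>, the endpoint is reached one step after the last interior point.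
  If one arc were shorter, its endpoint would be an interior point of the longer one.\<close>

lemma cyclic_consecutive_unique:
  assumes "N > 0" "S \<subseteq> {0..<N}"
    and "cyclic_consecutive N S p q" "cyclic_consecutive N S p q'"
  shows "q = q'"
proof -
  let ?l = "\<lambda>q. (q - p - 1) mod N"
  have arc_end: "(p + (?l x + 1)) mod N = x" if "x \<in> S" for x
  proof -
    have "(p + (?l x + 1)) mod N = (p + 1 + (x - p - 1)) mod N"
      by (metis ab_semigroup_add_class.add_ac(1) add.commute mod_add_right_eq)
    with that assms(2) show ?thesis by auto
  qed
  have no_shorter: "\<not> ?l x < ?l y" if "cyclic_consecutive N S p x" "cyclic_consecutive N S p y" for x y
  proof
    assume "?l x < ?l y"
    then have "?l x + 1 \<in> {1..?l y}" using assms(1) by simp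
    with that arc_end show False unfolding cyclic_consecutive_def by metis
  qed
  have "?l q = ?l q'"
    using no_shorter[OF assms(3,4)] no_shorter[OF assms(4,3)] by simp
  then show ?thesis
    using arc_end assms(3,4) unfolding cyclic_consecutive_def by metis
qed

lemma cyclic_consecutive_successor:
  fixes S :: "int set"
  defines "xs \<equiv> sorted_list_of_set S"
  assumes "N > 0" "S \<subseteq> {0..<N}" "k < length xs"
  shows "cyclic_consecutive N S (xs ! k) (xs ! ((k + 1) mod length xs))"
proof -
  have "finite S" using assms(3) finite_subset by blast
  then have S: "set xs = S" and sorted: "sorted_wrt (<) xs"
    unfolding xs_def by simp_all
  have less: "xs ! i < xs ! j" if "i < j" "j < length xs" for i j
    using that sorted by (simp add: sorted_wrt_iff_nth_less)
  have le: "xs ! i \<le> xs ! j" if "i \<le> j" "j < length xs" for i j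
    using that less[of i j] by (cases "i = j") auto
  have range: "0 \<le> xs ! i \<and> xs ! i < N" if "i < length xs" for i
    using that S assms(3) nth_mem by fastforce
  let ?p = "xs ! k" and ?q = "xs ! ((k + 1) mod length xs)"
  have "(k + 1) mod length xs < length xs" using assms(4) by (intro mod_less_divisor) auto
  then have mem: "?p \<in> S" "?q \<in> S" using S assms(4) nth_mem by blast+
  have "(?p + j) mod N \<notin> S" if j: "j \<in> {1..(?q - ?p - 1) mod N}" for j
  proof
    assume "(?p + j) mod N \<in> S"
    then obtain i where i: "i < length xs" "xs ! i = (?p + j) mod N"
      using S by (metis in_set_conv_nth)
    show False
    proof (cases "k + 1 < length xs")
      case True
      then have q: "?q = xs ! (k + 1)" by simp
      have "(?q - ?p - 1) mod N = ?q - ?p - 1"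
        using less[of k "k + 1"] range[of k] range[of "k + 1"] True q by simp
      with j have "?p < ?p + j" "?p + j < ?q" by auto
      moreover from this have "(?p + j) mod N = ?p + j"
        using range[of k] range[of "k + 1"] True q by simp
      ultimately have "?p < xs ! i" "xs ! i < xs ! (k + 1)" using i q by auto
      moreover have "i \<le> k \<or> k + 1 \<le> i" by linarith
      ultimately show False using le[of i k] le[of "k + 1" i] i True by auto
    \<comment> \<open>Here \<open>k\<close> is the last index, so the arc runs from the maximum of
      \<open>S\<close> through \<open>N\<close> to the minimum; a single onset is the case
      \<open>?q = ?p\<close>.\<close>
    next
      case False
      then have k: "k + 1 = length xs" "xs \<noteq> []" using assms(4) by auto
      then have q: "?q = xs ! 0" by simp
      have ends: "xs ! 0 \<le> xs ! i" "xs ! i \<le> ?p" "xs ! 0 \<le> ?p"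
        using le[of 0 i] le[of i k] le[of 0 k] i(1) k by auto
      have "(?q - ?p - 1) mod N = (?q - ?p - 1 + N) mod N" by simp
      also have "\<dots> = ?q - ?p - 1 + N"
        using range[of 0] range[of k] ends k q by (intro mod_pos_pos_trivial) auto
      finally have j': "1 \<le> j" "j < ?q - ?p + N" using j by auto
      \<comment> \<open>Before wrapping, a point of the arc exceeds the maximum; after wrapping, it
        is below the minimum.\<close>
      show False
      proof (cases "?p + j < N")
        case True
        then have "(?p + j) mod N = ?p + j" using j' range[of k] k by simp
        with i ends j' show False by simp
      next
        case False
        have "(?p + j) mod N = (?p + j - N) mod N" by simp
        also have "\<dots> = ?p + j - N"
          using False j' range[of 0] k q by (intro mod_pos_pos_trivial) auto
        finally show False using i ends j' q by simp
      qed
    qed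
  qed
  with mem show ?thesis unfolding cyclic_consecutive_def by blast
qed

text \<open>Trades list indices for a relation on the set itself. The converse rests on uniqueness:
  the list successor of \<open>p\<close> must be the given \<open>q\<close>.\<close>

lemma ex_successor_iff_cyclic_consecutive:
  fixes S :: "int set"
  defines "xs \<equiv> sorted_list_of_set S"
  assumes "N > 0" "S \<subseteq> {0..<N}"
  shows "(\<exists>k<length xs. R (xs ! k) (xs ! ((k + 1) mod length xs)))
    \<longleftrightarrow> (\<exists>p q. cyclic_consecutive N S p q \<and> R p q)"
proof
  assume "\<exists>k<length xs. R (xs ! k) (xs ! ((k + 1) mod length xs))"
  then show "\<exists>p q. cyclic_consecutive N S p q \<and> R p q"
    using cyclic_consecutive_successor[OF assms(2,3)] unfolding xs_def by blast
next
  assume "\<exists>p q. cyclic_consecutive N S p q \<and> R p q"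
  then obtain p q where pq: "cyclic_consecutive N S p q" "R p q" by blast
  have "finite S" using assms(3) finite_subset by blast
  then have "p \<in> set xs" using pq unfolding xs_def cyclic_consecutive_def by simp
  then obtain k where k: "k < length xs" "xs ! k = p" by (metis in_set_conv_nth)
  have "xs ! ((k + 1) mod length xs) = q"
    using cyclic_consecutive_unique[OF assms(2,3) _ pq(1)]
      cyclic_consecutive_successor[OF assms(2,3)] k unfolding xs_def by blast
  with k pq(2) show "\<exists>k<length xs. R (xs ! k) (xs ! ((k + 1) mod length xs))" by blast
qed

lemma Bav0_eq:
  assumes "N > 0"
  shows "Bav0 N v =
    of_bool (\<exists>p q. cyclic_consecutive N {i \<in> Zmod N. v i = 1} p q \<and> av N p q = 0)"
proof -
  have "{i \<in> Zmod N. v i = 1} \<subseteq> {0..<N}" "0 \<in> Zmod N"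
    using assms by (auto simp: Zmod_def)
  with ex_successor_iff_cyclic_consecutive[OF assms, of _ "\<lambda>p q. 0 = av N p q"]
  show ?thesis by (simp add: Bav0_def Bav_def onsets_def Let_def eq_commute[of 0])
qed

section \<open>Signed representatives of residues\<close>

lemma Zpm_eqI:
  assumes "a \<in> Zpm N" "b \<in> Zpm N" "a mod N = b mod N"
  shows "a = b"
proof (rule ccontr)
  assume "a \<noteq> b"
  moreover have "N dvd a - b" using assms(3) by (simp add: mod_eq_dvd_iff)
  moreover have "\<bar>a - b\<bar> < N" using assms(1,2) by (auto simp: Zpm_def)
  ultimately show False using dvd_imp_le_int[of "a - b" N] by auto
qed

lemma phi_inv_eq_mod:
  assumes "N > 0" "j \<in> Zpm N"
  shows "phi_inv N j = j mod N"
proof -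
  have "phi N (j mod N) = j"
  proof (cases "0 \<le> j")
    case True
    with assms have "j mod N = j" by (auto simp: Zpm_def)
    with assms show ?thesis by (simp add: Zpm_def phi_def)
  next
    case False
    have "j mod N = (j + N) mod N" by simp
    also have "\<dots> = j + N"
      using False assms by (intro mod_pos_pos_trivial) (auto simp: Zpm_def)
    finally show ?thesis using False assms by (auto simp: Zpm_def phi_def)
  qed
  moreover have "j mod N \<in> Zmod N" using assms by (simp add: Zmod_def)
  ultimately show ?thesis
    using bij_betw_phi[of N] unfolding phi_inv_def
    by (metis bij_betw_inv_into_left)
qed

lemma ex_Zpm_mod:
  assumes "N > 0"
  obtains j where "j \<in> Zpm N" "j mod N = x mod N"
proof
  have m: "x mod N \<in> Zmod N" using assms by (simp add: Zmod_def)
  show "phi N (x mod N) \<in> Zpm N" using bij_betw_phi m by (auto simp: bij_betw_def)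
  show "phi N (x mod N) mod N = x mod N" by (simp add: phi_def)
qed

section \<open>Parental pairs parametrised by arc length\<close>

definition parent_left :: "int \<Rightarrow> int" where "parent_left d = - (d div 2)"
definition parent_right :: "int \<Rightarrow> int" where "parent_right d = d - d div 2"

lemma parents_in_Zpm:
  assumes "0 \<le> d" "d < N"
  shows "parent_left d \<in> Zpm N" "parent_right d \<in> Zpm N"
  using assms unfolding parent_left_def parent_right_def Zpm_def by auto

lemma parent_right_minus_left: "parent_right d - parent_left d = d"
  by (simp add: parent_left_def parent_right_def)

lemma av_parents:
  assumes "0 \<le> d" "d < N"
  shows "av N (parent_left d mod N) (parent_right d mod N) = 0"
proof -
  have "(parent_right d mod N - parent_left d mod N) mod N = d"
    using assms by (simp add: mod_diff_eq parent_right_minus_left)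
  then show ?thesis
    by (simp add: av_def add_mod_def sub_mod_def mod_add_left_eq) (simp add: parent_left_def)
qed

text \<open>The average being \<open>0\<close> means \<open>p\<close> is congruent to
  \<open>- (d div 2)\<close>, and \<open>q\<close> is congruent to \<open>p + d\<close>.\<close>

lemma av_eq_0_imp_parents:
  assumes "N > 0" "av N p q = 0"
  defines "d \<equiv> (q - p) mod N"
  shows "p mod N = parent_left d mod N" "q mod N = parent_right d mod N"
proof -
  have "N dvd p + d div 2"
    using assms(2) by (simp add: av_def add_mod_def sub_mod_def d_def mod_eq_0_iff_dvd)
  then show left: "p mod N = parent_left d mod N"
    by (simp add: mod_eq_dvd_iff parent_left_def)
  have "q mod N = (p + d) mod N"
    by (simp add: d_def mod_add_right_eq)
  also have "\<dots> = (parent_left d + d) mod N"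
    using left by (metis mod_add_left_eq)
  also have "parent_left d + d = parent_right d"
    by (simp add: parent_left_def parent_right_def)
  finally show "q mod N = parent_right d mod N" .
qed

lemma Par_eq:
  assumes "N > 0"
  shows "Par N = (\<lambda>d. (parent_left d, parent_right d)) ` {0..<N}"
proof (intro set_eqI iffI)
  fix x assume "x \<in> Par N"
  then obtain a b where x: "x = (a, b)" and ab: "a \<in> Zpm N" "b \<in> Zpm N"
    and av: "av N (a mod N) (b mod N) = 0"
    using assms by (auto simp: Par_def phi_inv_eq_mod)
  define d where "d = (b mod N - a mod N) mod N"
  have d: "0 \<le> d" "d < N" using assms by (auto simp: d_def)
  have "a mod N = parent_left d mod N" "b mod N = parent_right d mod N"
    using av_eq_0_imp_parents[OF assms av] unfolding d_def[symmetric] by simp_all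
  then have "a = parent_left d" "b = parent_right d"
    using Zpm_eqI ab parents_in_Zpm[OF d] by blast+
  with d x show "x \<in> (\<lambda>d. (parent_left d, parent_right d)) ` {0..<N}" by auto
next
  fix x assume "x \<in> (\<lambda>d. (parent_left d, parent_right d)) ` {0..<N}"
  then show "x \<in> Par N"
    using assms by (auto simp: Par_def phi_inv_eq_mod parents_in_Zpm av_parents)
qed

lemma inj_parents: "inj (\<lambda>d. (parent_left d, parent_right d))"
  by (metis (mono_tags, lifting) injI parent_right_minus_left prod.inject)

lemma Par_minus_0_eq:
  assumes "N > 0"
  shows "Par N - {(0, 0)} = (\<lambda>d. (parent_left d, parent_right d)) ` {1..<N}"
proof -
  have "{(0, 0)} = (\<lambda>d. (parent_left d, parent_right d)) ` {0}"
    by (simp add: parent_left_def parent_right_def)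
  moreover have "{0..<N} - {0} = {1..<N}" by auto
  ultimately show ?thesis
    unfolding Par_eq[OF assms] using image_set_diff[OF inj_parents] by metis
qed

section \<open>The polynomials as indicator functions\<close>

lemma negated_coords_eq:
  assumes "N > 0" "j \<in> Zpm N"
  shows "negated_coords N v j = of_bool (v (j mod N) \<noteq> 1)"
    and "negated_coords N v j + 1 = of_bool (v (j mod N) = 1)"
  using assms by (cases "v (j mod N)"; simp add: negated_coords_def phi_inv_eq_mod)+

definition isolated_parents :: "int \<Rightarrow> (int \<Rightarrow> bit) \<Rightarrow> int \<Rightarrow> bool" where
  "isolated_parents N v d \<longleftrightarrow> v (parent_left d mod N) = 1 \<and> v (parent_right d mod N) = 1
     \<and> (\<forall>k\<in>{parent_left d + 1..parent_right d - 1}. v (k mod N) \<noteq> 1)"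

text \<open>Each factor is an indicator: \<open>y + 1\<close> detects an onset, \<open>y\<close> its
  absence. The product is therefore a conjunction.\<close>

lemma f_pair_parents:
  assumes "0 \<le> d" "d < N"
  shows "f_pair (parent_left d) (parent_right d) (negated_coords N v)
    = of_bool (isolated_parents N v d)"
proof -
  have N: "N > 0" using assms by simp
  have "k \<in> Zpm N" if "k \<in> {parent_left d + 1..parent_right d - 1}" for k
    using that parents_in_Zpm[OF assms] by (auto simp: Zpm_def)
  then have "(\<Prod>k\<in>{parent_left d + 1..parent_right d - 1}. negated_coords N v k)
      = (\<Prod>k\<in>{parent_left d + 1..parent_right d - 1}. of_bool (v (k mod N) \<noteq> 1))"
    using N by (intro prod.cong refl negated_coords_eq(1))
  also have "\<dots> = of_bool (\<forall>k\<in>{parent_left d + 1..parent_right d - 1}. v (k mod N) \<noteq> 1)"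
    by (rule prod_of_bool) simp
  finally show ?thesis
    unfolding f_pair_def isolated_parents_def
      negated_coords_eq(2)[OF N parents_in_Zpm(1)[OF assms]]
      negated_coords_eq(2)[OF N parents_in_Zpm(2)[OF assms]]
    by (simp only: of_bool_conj mult.assoc mult.left_commute mult.commute)
qed

text \<open>Not the case \<open>d = 0\<close> of \<open>isolated_parents\<close>: there the interval
  is empty and only \<open>v 0 = 1\<close> would remain, whereas the arc from \<open>0\<close> to
  itself is the full circle.\<close>

definition isolated_zero :: "int \<Rightarrow> (int \<Rightarrow> bit) \<Rightarrow> bool" where
  "isolated_zero N v \<longleftrightarrow> v 0 = 1 \<and> (\<forall>k\<in>Zpm N - {0}. v (k mod N) \<noteq> 1)"

lemma f_zero_eq:
  assumes "N > 0"
  shows "f_zero N (negated_coords N v) = of_bool (isolated_zero N v)"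
proof -
  have "0 \<in> Zpm N" using assms by (simp add: Zpm_def)
  from negated_coords_eq(2)[OF assms this]
  have "negated_coords N v 0 + 1 = of_bool (v 0 = 1)" by simp
  moreover have "(\<Prod>k\<in>Zpm N - {0}. negated_coords N v k)
      = (\<Prod>k\<in>Zpm N - {0}. of_bool (v (k mod N) \<noteq> 1))"
    using assms by (intro prod.cong refl negated_coords_eq(1)) auto
  moreover have "\<dots> = of_bool (\<forall>k\<in>Zpm N - {0}. v (k mod N) \<noteq> 1)"
    by (rule prod_of_bool) (simp add: Zpm_def)
  ultimately show ?thesis
    by (simp only: f_zero_def isolated_zero_def of_bool_conj)
qed

section \<open>Mutual exclusion of the summands\<close>

lemma isolated_parents_unique:
  assumes "1 \<le> d" "1 \<le> e" "isolated_parents N v d" "isolated_parents N v e"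
  shows "d = e"
proof -
  have "\<not> d < e" if "1 \<le> d" "isolated_parents N v d" "isolated_parents N v e" for d e
  proof
    assume "d < e"
    \<comment> \<open>If the halves differ, the left end moves strictly inside. If they agree, then
      \<open>d\<close> is even and \<open>e = d + 1\<close>, so the right end does; this needs
      \<open>d\<close> to be positive.\<close>
    with that(1) have "parent_left d \<in> {parent_left e + 1..parent_right e - 1}
        \<or> parent_right d \<in> {parent_left e + 1..parent_right e - 1}"
      by (cases "d div 2 = e div 2") (auto simp: parent_left_def parent_right_def)
    with that(2,3) show False unfolding isolated_parents_def by blast
  qed
  with assms show ?thesis by (metis linorder_neqE)
qed

text \<open>For positive \<open>d\<close> the right parent is positive, hence an onset other than
  \<open>0\<close>.\<close>

lemma not_isolated_parents_and_zero:
  assumes "1 \<le> d" "d < N" "isolated_parents N v d"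
  shows "\<not> isolated_zero N v"
proof
  assume "isolated_zero N v"
  moreover have "parent_right d \<in> Zpm N - {0}"
    using assms(1,2) parents_in_Zpm[of d N] by (auto simp: parent_right_def)
  ultimately show False
    using assms(3) unfolding isolated_zero_def isolated_parents_def by blast
qed

section \<open>Consecutive onsets averaging to zero\<close>

lemma cyclic_consecutive_parents_iff:
  assumes "1 \<le> d" "d < N"
  shows "cyclic_consecutive N {i \<in> Zmod N. v i = 1} (parent_left d mod N) (parent_right d mod N)
    \<longleftrightarrow> isolated_parents N v d"
proof -
  have "(parent_right d mod N - parent_left d mod N - 1) mod N
      = (parent_right d - parent_left d - 1) mod N"
    by (metis mod_diff_left_eq mod_diff_eq)
  also have "\<dots> = d - 1" using assms by (simp add: parent_right_minus_left)
  finally have len: "(parent_right d mod N - parent_left d mod N - 1) mod N = d - 1" .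
  \<comment> \<open>Translation by \<open>parent_left d\<close> matches steps along the arc with
    integers of the interval.\<close>
  have "{parent_left d + 1..parent_right d - 1} = (+) (parent_left d) ` {1..d - 1}"
    using parent_right_minus_left[of d] by (simp add: algebra_simps)
  then have interior: "(\<forall>k\<in>{parent_left d + 1..parent_right d - 1}. v (k mod N) \<noteq> 1)
      \<longleftrightarrow> (\<forall>j\<in>{1..d - 1}. v ((parent_left d + j) mod N) \<noteq> 1)"
    by (simp only: ball_simps)
  with assms show ?thesis
    unfolding cyclic_consecutive_def isolated_parents_def len interior
    by (simp add: Zmod_def mod_add_left_eq)
qed

text \<open>Both \<open>{1..N - 1}\<close> and \<open>Zpm N - {0}\<close> represent every nonzero
  residue exactly once.\<close>

lemma cyclic_consecutive_zero_iff:
  assumes "N > 0"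
  shows "cyclic_consecutive N {i \<in> Zmod N. v i = 1} 0 0 \<longleftrightarrow> isolated_zero N v"
proof -
  have len: "(0 - 0 - 1) mod N = N - 1" using assms by (simp add: zmod_minus1)
  have "(\<forall>j\<in>{1..N - 1}. v (j mod N) \<noteq> 1) \<longleftrightarrow> (\<forall>k\<in>Zpm N - {0}. v (k mod N) \<noteq> 1)"
  proof (intro iffI ballI)
    fix k assume *: "\<forall>j\<in>{1..N - 1}. v (j mod N) \<noteq> 1" and k: "k \<in> Zpm N - {0}"
    have "k mod N \<noteq> 0"
      using k assms Zpm_eqI[of k N 0] by (auto simp: Zpm_def)
    then have "k mod N \<in> {1..N - 1}"
      using assms pos_mod_sign[of N k] pos_mod_bound[of N k]
      by (simp add: order_less_le; linarith)
    with * show "v (k mod N) \<noteq> 1" by (metis mod_mod_trivial)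
  next
    fix j assume *: "\<forall>k\<in>Zpm N - {0}. v (k mod N) \<noteq> 1" and j: "j \<in> {1..N - 1}"
    obtain k where k: "k \<in> Zpm N" "k mod N = j mod N" using ex_Zpm_mod[OF assms] .
    with j have "k \<noteq> 0" by auto
    with * k show "v (j mod N) \<noteq> 1" by (metis Diff_iff singletonD)
  qed
  with assms show ?thesis
    unfolding cyclic_consecutive_def isolated_zero_def len by (simp add: Zmod_def)
qed

lemma ex_cyclic_consecutive_av_0_iff:
  assumes "N > 0"
  shows "(\<exists>p q. cyclic_consecutive N {i \<in> Zmod N. v i = 1} p q \<and> av N p q = 0)
    \<longleftrightarrow> (\<exists>d\<in>{1..<N}. isolated_parents N v d) \<or> isolated_zero N v"
    (is "(\<exists>p q. ?C p q \<and> _) \<longleftrightarrow> ?R")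
proof
  assume "\<exists>p q. ?C p q \<and> av N p q = 0"
  then obtain p q where C: "?C p q" and av: "av N p q = 0" by blast
  define d where "d = (q - p) mod N"
  have "p mod N = p" "q mod N = q"
    using C by (auto simp: cyclic_consecutive_def Zmod_def)
  then have pq: "p = parent_left d mod N" "q = parent_right d mod N"
    using av_eq_0_imp_parents[OF assms av] unfolding d_def by auto
  have d: "0 \<le> d" "d < N" using assms by (auto simp: d_def)
  show ?R
  proof (cases "d = 0")
    case True
    then have "p = 0" "q = 0" using pq by (auto simp: parent_left_def parent_right_def)
    with C show ?thesis using cyclic_consecutive_zero_iff[OF assms] by simp
  next
    case False
    with d have "1 \<le> d" by simp
    with C d pq show ?thesis using cyclic_consecutive_parents_iff[of d N v] by auto
  qed
next
  assume ?R
  then show "\<exists>p q. ?C p q \<and> av N p q = 0"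
  proof
    assume "\<exists>d\<in>{1..<N}. isolated_parents N v d"
    then obtain d where "1 \<le> d" "d < N" "isolated_parents N v d" by auto
    then show ?thesis
      using cyclic_consecutive_parents_iff[of d N v] av_parents[of d N] by force
  next
    assume "isolated_zero N v"
    then have "?C 0 0" using cyclic_consecutive_zero_iff[OF assms] by simp
    moreover have "av N 0 0 = 0" by (simp add: av_def add_mod_def sub_mod_def)
    ultimately show ?thesis by blast
  qed
qed

theorem theorem5p2:
  fixes N :: int
  assumes "N \<ge> 3"
  shows "\<forall>v \<in> F2_vectors (Zmod N).
    Bav0 N v =
      (\<Sum>(a, b) \<in> Par N - {(0, 0)}. f_pair a b (negated_coords N v))
      + f_zero N (negated_coords N v)"
proof
  fix v
  have N: "N > 0" using assms by simp
  let ?E = "\<exists>d\<in>{1..<N}. isolated_parents N v d"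
  have "(\<Sum>(a, b) \<in> Par N - {(0, 0)}. f_pair a b (negated_coords N v))
      = (\<Sum>d\<in>{1..<N}. f_pair (parent_left d) (parent_right d) (negated_coords N v))"
    unfolding Par_minus_0_eq[OF N]
    by (subst sum.reindex) (auto intro: inj_on_subset[OF inj_parents])
  also have "\<dots> = (\<Sum>d\<in>{1..<N}. of_bool (isolated_parents N v d))"
    by (intro sum.cong refl f_pair_parents) auto
  also have "\<dots> = of_bool ?E"
    by (rule sum_of_bool_at_most_one) (auto intro: isolated_parents_unique)
  finally have sum: "(\<Sum>(a, b) \<in> Par N - {(0, 0)}. f_pair a b (negated_coords N v))
      = of_bool ?E" .
  \<comment> \<open>Excludes the case \<open>1 + 1 = 0\<close>, the only one in which the sum in
    \<open>bit\<close> would differ from the disjunction.\<close>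
  have "\<not> (?E \<and> isolated_zero N v)" using not_isolated_parents_and_zero by auto
  then have "of_bool (?E \<or> isolated_zero N v) = (of_bool ?E + of_bool (isolated_zero N v) :: bit)"
    by auto
  then show "Bav0 N v =
      (\<Sum>(a, b) \<in> Par N - {(0, 0)}. f_pair a b (negated_coords N v))
      + f_zero N (negated_coords N v)"
    by (simp only: sum f_zero_eq[OF N] Bav0_eq[OF N] ex_cyclic_consecutive_av_0_iff[OF N])
qed

end
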